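(* Consider a module $M$ with $N_M$ class queues with backlogs $q_i^M(t)\in\mathbb{R}_{\ge 0}$, $i=1,\dots,N_M$, $t=0,1,2,\dots$, evolving by $$q_i^M(t+1)=\big[q_i^M(t)+a_i^M(t)+\mathrm{in}_i^M(t)-s_i^M(t)\big]_+ ,$$ where $a_i^M(t)$ are exogenous arrivals, $\mathrm{in}_i^M(t)$ is routed inflow, and $s_i^M(t)\ge 0$ is the total removal of the executed action. Fix backlog caps $Q_i^{M,\max}>0$ and the safe set $$\mathcal{S}^M=\{q\in\mathbb{R}_{\ge 0}^{N_M}: q_i\le Q_i^{M,\max}\ \text{for all } i\}.$$ Assume the declared envelopes $0\le a_i^M(t)\le \bar a_i^M(t)$ and $0\le \mathrm{in}_i^M(t)\le \overline{\mathrm{in}}_i^M(t)$ hold, and put $\bar A_i^M(t)=\bar a_i^M(t)+\overline{\mathrm{in}}_i^M(t)$. (1) Suppose that at time $t$ the certified operator of $M$ reports status $\texttt{CERTIFIED}$, that the state value $\overline q^M(t)$ used for certification is valid for the current queue state (i.e. $q_i^M(t)\le \overline q_i^M(t)$ for all $i$; in particular $\overline q^M(t)=q^M(t)$ is allowed), and that the operator enforces the barrier constraint with the declared envelope, i.e. $$\overline q_i^M(t)+\bar A_i^M(t)-s_i^M(t)\le Q_i^{M,\max}\qquad\text{for all } i .$$ If $q^M(t)\in\mathcal{S}^M$, then $q^M(t+1)\in\mathcal{S}^M$. (2) Consequently, if $q^M(0)\in\mathcal{S}^M$, the envelopes and state bounds remain valid for all $t$, and the status is $\texttt{CERTIFIED}$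 for all $t$ (so that the barrier constraint above is enforced for all $t$), then $q^M(t)\in\mathcal{S}^M$ for all $t\ge 0$.
   Context: Time is slotted. $[x]_+=\max\{x,0\}$. The executed action of a module consists of service $\mu_i^M(t)\ge 0$ and shedding $\delta_i^M(t)\ge 0$ for each class $i$; the total (realised) removal is $s_i^M(t)=\mu_i^M(t)+\delta_i^M(t)$. The certified operator is a component that maps an arbitrary proposed action, together with a backlog value or upper bound $\overline q^M(t)$, the total arrival envelope $\bar A^M(t)$, and capacity data, to an executed action and a status flag. For the purposes of this statement, status $\texttt{CERTIFIED}$ at time $t$ means that the executed action satisfies the enforced constraints exactly (zero slack), in particular the barrier constraint written in the claim. When only a bound on the backlog is available, the operator uses the upper bound $\overline q^M(t)$ in place of $q^M(t)$ in the barrier constraint. *)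

theory Defs
  imports "HOL-Analysis.Finite_Cartesian_Product"
begin

(* The class queues of a module are indexed by a finite type 'n, so N_M = CARD('n). *)

record 'n action =
  service :: "real ^ 'n"
  shed :: "real ^ 'n"

definition removal :: "('n::finite) action \<Rightarrow> real ^ 'n" where
  "removal u = service u + shed u"

definition nonneg_action :: "('n::finite) action \<Rightarrow> bool" where
  "nonneg_action u \<longleftrightarrow> (\<forall>i. 0 \<le> service u $ i \<and> 0 \<le> shed u $ i)"

datatype status = CERTIFIED | NOT_CERTIFIED

(* Arguments: proposed action, backlog value or upper bound, total arrival envelope,
   capacity data.  Proposed actions and capacity data are left completely arbitrary. *)
type_synonym ('p, 'c, 'n) operator =
  "'p \<Rightarrow> real ^ 'n \<Rightarrow> real ^ 'n \<Rightarrow> 'c \<Rightarrow> 'n action \<times> status"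

(* The conjunction of the constraints an operator enforces, as a condition on the executed
   action given the backlog bound, the total arrival envelope and the capacity data. *)
type_synonym ('c, 'n) constraints =
  "real ^ 'n \<Rightarrow> real ^ 'n \<Rightarrow> 'c \<Rightarrow> 'n action \<Rightarrow> bool"

(* The executed action is always nonnegative; status CERTIFIED means that it satisfies the
   enforced constraints with zero slack.  Nothing is promised under any other status. *)
definition certified_operator ::
    "('c, 'n::finite) constraints \<Rightarrow> ('p, 'c, 'n) operator \<Rightarrow> bool" where
  "certified_operator C oper \<longleftrightarrow>
     (\<forall>p qb Ab c. nonneg_action (fst (oper p qb Ab c)) \<and>
        (snd (oper p qb Ab c) = CERTIFIED \<longrightarrow> C qb Ab c (fst (oper p qb Ab c))))"

definition barrier ::
    "real ^ 'n \<Rightarrow> real ^ 'n \<Rightarrow> real ^ 'n \<Rightarrow> ('n::finite) action \<Rightarrow> bool" where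
  "barrier Qmax qb Ab u \<longleftrightarrow> (\<forall>i. qb $ i + Ab $ i - removal u $ i \<le> Qmax $ i)"

(* The barrier constraint is among the constraints enforced on these inputs. *)
definition enforces_barrier ::
    "real ^ 'n \<Rightarrow> ('c, 'n::finite) constraints \<Rightarrow> real ^ 'n \<Rightarrow> real ^ 'n \<Rightarrow> 'c \<Rightarrow> bool" where
  "enforces_barrier Qmax C qb Ab c \<longleftrightarrow> (\<forall>u. C qb Ab c u \<longrightarrow> barrier Qmax qb Ab u)"

definition safe_set :: "real ^ 'n \<Rightarrow> (real ^ 'n::finite) set" where
  "safe_set Qmax = {q. \<forall>i. 0 \<le> q $ i \<and> q $ i \<le> Qmax $ i}"

definition pos_part :: "real \<Rightarrow> real" where
  "pos_part x = max x 0"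

definition envelope_valid :: "real ^ 'n \<Rightarrow> real ^ 'n::finite \<Rightarrow> bool" where
  "envelope_valid x xbar \<longleftrightarrow> (\<forall>i. 0 \<le> x $ i \<and> x $ i \<le> xbar $ i)"

definition state_bound_valid :: "real ^ 'n \<Rightarrow> real ^ 'n::finite \<Rightarrow> bool" where
  "state_bound_valid q qbar \<longleftrightarrow> (\<forall>i. q $ i \<le> qbar $ i)"

end

theory Submission
  imports Defs
begin

text \<open>The barrier bounds the worst case: replacing backlog, arrivals and inflow by their upper
  bounds can only increase q + a + in - s, so the true value before truncation is at most the cap in
  every class. Truncation at zero makes it nonnegative and, as caps are nonnegative, keeps it below
  the cap. \<open>barrier_step_safe\<close> is this one-step estimate;
  \<open>certified_barrier\<close> supplies its barrier hypothesis, passing from the status to the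
  enforced constraints \<open>C\<close> and from there to \<open>barrier\<close>.\<close>

lemma certified_barrier:
  assumes "certified_operator C oper"
    and "(u, CERTIFIED) = oper p qb Ab c"
    and "enforces_barrier Qmax C qb Ab c"
  shows "barrier Qmax qb Ab u"
  using assms unfolding certified_operator_def enforces_barrier_def
  by (metis fst_conv snd_conv)

lemma barrier_step_safe:
  fixes x y q q' :: "real ^ 'n::finite"
  assumes "\<And>i. 0 \<le> Qmax $ i"
    and "envelope_valid x xbar" and "envelope_valid y ybar"
    and "state_bound_valid q qb"
    and "barrier Qmax qb (xbar + ybar) u"
    and "\<And>i. q' $ i = pos_part (q $ i + x $ i + y $ i - removal u $ i)"
  shows "q' \<in> safe_set Qmax"
proof -
  have "q $ i + x $ i + y $ i - removal u $ i \<le> Qmax $ i" for i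
  proof -
    have "q $ i \<le> qb $ i" "x $ i \<le> xbar $ i" "y $ i \<le> ybar $ i"
      and "qb $ i + (xbar $ i + ybar $ i) - removal u $ i \<le> Qmax $ i"
      using assms(2-5)
      by (simp_all add: envelope_valid_def state_bound_valid_def barrier_def)
    then show ?thesis by linarith
  qed
  \<comment> \<open>A maximum with 0 stays below the cap only because 0 does too; this is where
    nonnegativity of \<open>Qmax\<close> enters.\<close>
  with assms(1) show ?thesis
    by (simp add: safe_set_def assms(6) pos_part_def)
qed

theorem theorem2:
  fixes q qbar a abar inflow inbar Abar :: "nat \<Rightarrow> real ^ 'n::finite"
    and Qmax :: "real ^ 'n"
    and oper :: "('p, 'c, 'n) operator"
    and C :: "('c, 'n) constraints"
    and proposed :: "nat \<Rightarrow> 'p"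
    and cap :: "nat \<Rightarrow> 'c"
    and exec :: "nat \<Rightarrow> 'n action"
    and stat :: "nat \<Rightarrow> status"
  assumes "\<And>i. 0 < Qmax $ i"
    and "\<And>t i. 0 \<le> q t $ i"
    and "\<And>t. Abar t = abar t + inbar t"
    and "certified_operator C oper"
    and "\<And>t. (exec t, stat t) = oper (proposed t) (qbar t) (Abar t) (cap t)"
    and "\<And>t i. q (Suc t) $ i = pos_part (q t $ i + a t $ i + inflow t $ i - removal (exec t) $ i)"
  shows "(\<forall>t. envelope_valid (a t) (abar t) \<and> envelope_valid (inflow t) (inbar t) \<and>
              stat t = CERTIFIED \<and> state_bound_valid (q t) (qbar t) \<and>
              enforces_barrier Qmax C (qbar t) (Abar t) (cap t) \<and>
              q t \<in> safe_set Qmax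
            \<longrightarrow> q (Suc t) \<in> safe_set Qmax) \<and>
         (q 0 \<in> safe_set Qmax \<and>
            (\<forall>t. envelope_valid (a t) (abar t) \<and> envelope_valid (inflow t) (inbar t) \<and>
                 state_bound_valid (q t) (qbar t)) \<and>
            (\<forall>t. stat t = CERTIFIED \<and> enforces_barrier Qmax C (qbar t) (Abar t) (cap t))
            \<longrightarrow> (\<forall>t. q t \<in> safe_set Qmax))"
proof -
  have step: "q (Suc t) \<in> safe_set Qmax"
    if "envelope_valid (a t) (abar t)" "envelope_valid (inflow t) (inbar t)"
      "stat t = CERTIFIED" "state_bound_valid (q t) (qbar t)"
      "enforces_barrier Qmax C (qbar t) (Abar t) (cap t)" for t
  proof (rule barrier_step_safe[OF _ that(1,2,4) _ assms(6)])
    show "0 \<le> Qmax $ i" for i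
      using assms(1) by (rule less_imp_le)
    \<comment> \<open>The operator sees only the total envelope \<open>Abar t\<close>; splitting it
      into its two summands matches the separate bounds on arrivals and inflow.\<close>
    show "barrier Qmax (qbar t) (abar t + inbar t) (exec t)"
      using certified_barrier[OF assms(4) _ that(5)] assms(5)[of t] that(3)
      by (simp add: assms(3))
  qed
  have "q t \<in> safe_set Qmax"
    if "q 0 \<in> safe_set Qmax"
      and "\<forall>t. envelope_valid (a t) (abar t) \<and> envelope_valid (inflow t) (inbar t) \<and>
             state_bound_valid (q t) (qbar t)"
      and "\<forall>t. stat t = CERTIFIED \<and> enforces_barrier Qmax C (qbar t) (Abar t) (cap t)" for t
    \<comment> \<open>A case distinction replaces induction: time 0 is the initial assumption, and
      every \<open>Suc\<close> time is reached by \<open>step\<close> from the bounds and the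
      certificate at its predecessor.\<close>
    using that step by (cases t) auto
  with step show ?thesis by blast
qed

end
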